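(* Let $\mathcal{S}$ be a small category admitting binary products, with subcategories $\mathcal{S}^{sm}$ (smooth morphisms) and $\mathcal{S}^{cl}$ (closed immersions) satisfying conditions (i)--(iv) listed in the context. For $j=1,2$ let $\mathbb{H}_j$ be an $\mathcal{S}$-fibered category with an external tensor structure $(\boxtimes_j,m_j)$, with underlying external tensor skeleton $(\boxtimes_j,m_j^{sm},m_j^{cl})$ (the restrictions of $m_j$ to $\mathcal{S}^{sm}$ and $\mathcal{S}^{cl}$), and let $R=(\mathcal{R},\theta):\mathbb{H}_1\to\mathbb{H}_2$ be a morphism of $\mathcal{S}$-fibered categories. Then an external tensor skeleton on $R$ (with respect to $(\boxtimes_1,m_1^{sm},m_1^{cl})$ and $(\boxtimes_2,m_2^{sm},m_2^{cl})$) is the same as an external tensor structure on $R$ (with respect to $(\boxtimes_1,m_1)$ and $(\boxtimes_2,m_2)$): a family of natural isomorphisms $\rho_{S_1,S_2}:R_{S_1}(A_1)\boxtimes_2R_{S_2}(A_2)\xrightarrow{\sim}R_{S_1\times S_2}(A_1\boxtimes_1A_2)$ is an external tensor skeleton on $R$ if and only if it is an external tensor structure on $R$.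
   Context: Standing assumptions on $\mathcal{S}$: two (possibly non-full) subcategories $\mathcal{S}^{sm},\mathcal{S}^{cl}$ are given such that: (i) both have the same objects as $\mathcal{S}$ and contain all isomorphisms; (ii) for every $p:P\to S$ in $\mathcal{S}^{sm}$ and every $f:T\to S$ in $\mathcal{S}$ the fibered product $P\times_S T$ exists, and every base change of a morphism of $\mathcal{S}^{sm}$ lies in $\mathcal{S}^{sm}$; (iii) in every Cartesian square with sides $z':P_Z\to P$, $p':P_Z\to Z$, $p:P\to S$ in $\mathcal{S}^{sm}$, $z:Z\to S$ in $\mathcal{S}^{cl}$, the morphism $z'$ is in $\mathcal{S}^{cl}$; and if $gz$ is in $\mathcal{S}^{cl}$ then $z$ is in $\mathcal{S}^{cl}$; (iv) every morphism $f$ of $\mathcal{S}$ factors as $f=p\circ t$ with $t$ in $\mathcal{S}^{cl}$ and $p$ in $\mathcal{S}^{sm}$. An $\mathcal{S}$-fibered category $\mathbb{H}$: categories $\mathbb{H}(S)$, functors $f^*:\mathbb{H}(S)\to\mathbb{H}(T)$ for $f:T\to S$, and natural isomorphisms $\mathrm{conn}_{f,g}:(gf)^*A\xrightarrow{\sim}f^*g^*A$ with $\mathrm{id}_S^*=\mathrm{id}$ and $f^*\mathrm{conn}_{g,h}\circ\mathrm{conn}_{f,hg}=\mathrm{conn}_{f,g}\circ\mathrm{conn}_{gf,h}$; composites of these are written as equalities. A morphism $R=(\mathcal{R},\theta):\mathbb{H}_1\to\mathbb{H}_2$ consists of functors $R_S:\mathbb{H}_1(S)\to\mathbb{H}_2(S)$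 and natural isomorphisms $\theta_f:f^*R_S(A)\xrightarrow{\sim}R_T(f^*A)$ for $f:T\to S$ with $\theta_{gf}=\theta_f\circ f^*\theta_g$ modulo $(gf)^*=f^*g^*$. An external tensor structure $(\boxtimes,m)$ on $\mathbb{H}$ consists of functors $\boxtimes:\mathbb{H}(S_1)\times\mathbb{H}(S_2)\to\mathbb{H}(S_1\times S_2)$ and natural isomorphisms $m_{f_1,f_2}:f_1^*A_1\boxtimes f_2^*A_2\xrightarrow{\sim}(f_1\times f_2)^*(A_1\boxtimes A_2)$ for $f_i:T_i\to S_i$, such that $m_{g_1f_1,g_2f_2}=(f_1\times f_2)^*m_{g_1,g_2}\circ m_{f_1,f_2}$ modulo connection isomorphisms. For $\mathcal{S}'=\mathcal{S},\mathcal{S}^{sm},\mathcal{S}^{cl}$, an external tensor structure $\rho$ on (the restriction to $\mathcal{S}'$ of) $R$ is a family of natural isomorphisms $\rho_{S_1,S_2}:R_{S_1}(A_1)\boxtimes_2R_{S_2}(A_2)\xrightarrow{\sim}R_{S_1\times S_2}(A_1\boxtimes_1A_2)$, $S_1,S_2\in\mathcal{S}$, such that for all $f_i:T_i\to S_i$ in $\mathcal{S}'$ ($i=1,2$) the composites $$f_1^*R_{S_1}(A_1)\boxtimes_2f_2^*R_{S_2}(A_2)\xrightarrow{m_2}(f_1\times f_2)^*(R_{S_1}(A_1)\boxtimes_2R_{S_2}(A_2))\xrightarrow{\rho}(f_1\times f_2)^*R_{S_1\times S_2}(A_1\boxtimes_1A_2)\xrightarrow{\theta}R_{T_1\times T_2}((f_1\times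 f_2)^*(A_1\boxtimes_1A_2)),$$ $$f_1^*R_{S_1}(A_1)\boxtimes_2f_2^*R_{S_2}(A_2)\xrightarrow{\theta}R_{T_1}(f_1^*A_1)\boxtimes_2R_{T_2}(f_2^*A_2)\xrightarrow{\rho}R_{T_1\times T_2}(f_1^*A_1\boxtimes_1f_2^*A_2)\xrightarrow{m_1}R_{T_1\times T_2}((f_1\times f_2)^*(A_1\boxtimes_1A_2))$$ coincide. An external tensor skeleton on $R$ consists of an external tensor structure $\rho^{sm}$ on the restriction of $R$ to $\mathcal{S}^{sm}$ (with respect to $m_1^{sm},m_2^{sm}$) and an external tensor structure $\rho^{cl}$ on the restriction of $R$ to $\mathcal{S}^{cl}$ (with respect to $m_1^{cl},m_2^{cl}$) such that $\rho^{sm}_{S_1,S_2}=\rho^{cl}_{S_1,S_2}$ for all $S_1,S_2$ (the common family is denoted $\rho$). *)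

theory Defs
  imports Main
begin

section \<open>Categories, functors, natural isomorphisms\<close>

text \<open>\<open>g \<cdot>\<^bsub>C\<^esub> f\<close> is the composite ``first \<open>f\<close>, then \<open>g\<close>''; it is only meaningful
  if \<open>Cod C f = Dom C g\<close>.  Objects and arrows form sets, so every category here is small.\<close>

record ('o, 'm) category_data =
  Ob :: "'o set"
  Ar :: "'m set"
  Dom :: "'m \<Rightarrow> 'o"
  Cod :: "'m \<Rightarrow> 'o"
  Ident :: "'o \<Rightarrow> 'm"
  Comp :: "'m \<Rightarrow> 'm \<Rightarrow> 'm"  (infixr "\<cdot>\<index>" 70)

definition Hom :: "('o, 'm, 'z) category_data_scheme \<Rightarrow> 'o \<Rightarrow> 'o \<Rightarrow> 'm set" where
  "Hom C X Y = {f \<in> Ar C. Dom C f = X \<and> Cod C f = Y}"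

locale category =
  fixes C :: "('o, 'm, 'z) category_data_scheme" (structure)
  assumes Dom_closed: "f \<in> Ar C \<Longrightarrow> Dom C f \<in> Ob C"
    and Cod_closed: "f \<in> Ar C \<Longrightarrow> Cod C f \<in> Ob C"
    and Ident_Hom: "X \<in> Ob C \<Longrightarrow> Ident C X \<in> Hom C X X"
    and Comp_Hom: "\<lbrakk>f \<in> Hom C X Y; g \<in> Hom C Y Z\<rbrakk> \<Longrightarrow> g \<cdot> f \<in> Hom C X Z"
    and Comp_Ident_right: "f \<in> Hom C X Y \<Longrightarrow> f \<cdot> Ident C X = f"
    and Comp_Ident_left: "f \<in> Hom C X Y \<Longrightarrow> Ident C Y \<cdot> f = f"
    and Comp_assoc: "\<lbrakk>f \<in> Hom C X Y; g \<in> Hom C Y Z; h \<in> Hom C Z W\<rbrakk>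
                     \<Longrightarrow> h \<cdot> (g \<cdot> f) = (h \<cdot> g) \<cdot> f"

definition is_iso :: "('o, 'm, 'z) category_data_scheme \<Rightarrow> 'm \<Rightarrow> bool" where
  "is_iso C f \<longleftrightarrow> f \<in> Ar C \<and>
     (\<exists>g \<in> Hom C (Cod C f) (Dom C f).
        g \<cdot>\<^bsub>C\<^esub> f = Ident C (Dom C f) \<and> f \<cdot>\<^bsub>C\<^esub> g = Ident C (Cod C f))"

definition prod_category ::
  "('o1, 'm1, 'z1) category_data_scheme \<Rightarrow> ('o2, 'm2, 'z2) category_data_scheme
     \<Rightarrow> ('o1 \<times> 'o2, 'm1 \<times> 'm2) category_data" where
  "prod_category C D =
     \<lparr>Ob = Ob C \<times> Ob D, Ar = Ar C \<times> Ar D,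
      Dom = map_prod (Dom C) (Dom D), Cod = map_prod (Cod C) (Cod D),
      Ident = map_prod (Ident C) (Ident D),
      Comp = (\<lambda>g f. (fst g \<cdot>\<^bsub>C\<^esub> fst f, snd g \<cdot>\<^bsub>D\<^esub> snd f))\<rparr>"

record ('a, 'b, 'c, 'd) functor_data =
  fobj :: "'a \<Rightarrow> 'c"
  farr :: "'b \<Rightarrow> 'd"

locale category_functor = source: category C + target: category D
  for C :: "('a, 'b, 'y) category_data_scheme" and D :: "('c, 'd, 'z) category_data_scheme" +
  fixes F :: "('a, 'b, 'c, 'd) functor_data"
  assumes fobj_closed: "A \<in> Ob C \<Longrightarrow> fobj F A \<in> Ob D"
    and farr_Hom: "a \<in> Hom C A B \<Longrightarrow> farr F a \<in> Hom D (fobj F A) (fobj F B)"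
    and farr_Ident: "A \<in> Ob C \<Longrightarrow> farr F (Ident C A) = Ident D (fobj F A)"
    and farr_Comp: "\<lbrakk>a \<in> Hom C A B; b \<in> Hom C B E\<rbrakk>
                    \<Longrightarrow> farr F (b \<cdot>\<^bsub>C\<^esub> a) = farr F b \<cdot>\<^bsub>D\<^esub> farr F a"

definition comp_functor ::
  "('c, 'd, 'e, 'f) functor_data \<Rightarrow> ('a, 'b, 'c, 'd) functor_data \<Rightarrow> ('a, 'b, 'e, 'f) functor_data"
  (infixr "\<circ>\<^sub>F" 70) where
  "G \<circ>\<^sub>F F = \<lparr>fobj = fobj G \<circ> fobj F, farr = farr G \<circ> farr F\<rparr>"

definition prod_functor ::
  "('a1, 'b1, 'c1, 'd1) functor_data \<Rightarrow> ('a2, 'b2, 'c2, 'd2) functor_data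
     \<Rightarrow> ('a1 \<times> 'a2, 'b1 \<times> 'b2, 'c1 \<times> 'c2, 'd1 \<times> 'd2) functor_data"
  (infixr "\<times>\<^sub>F" 75) where
  "F \<times>\<^sub>F G = \<lparr>fobj = map_prod (fobj F) (fobj G), farr = map_prod (farr F) (farr G)\<rparr>"

locale natural_iso = F: category_functor C D F + G: category_functor C D G
  for C :: "('a, 'b, 'y) category_data_scheme" and D :: "('c, 'd, 'z) category_data_scheme"
    and F G :: "('a, 'b, 'c, 'd) functor_data" +
  fixes \<eta> :: "'a \<Rightarrow> 'd"
  assumes component_Hom: "A \<in> Ob C \<Longrightarrow> \<eta> A \<in> Hom D (fobj F A) (fobj G A)"
    and component_iso: "A \<in> Ob C \<Longrightarrow> is_iso D (\<eta> A)"
    and naturality: "a \<in> Hom C A B \<Longrightarrow> farr G a \<cdot>\<^bsub>D\<^esub> \<eta> A = \<eta> B \<cdot>\<^bsub>D\<^esub> farr F a"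


section \<open>The base category\<close>

text \<open>Binary products are chosen: \<open>Prod S X Y\<close> with projections \<open>pr1 S X Y\<close>, \<open>pr2 S X Y\<close>.\<close>

record ('o, 'm) product_category_data = "('o, 'm) category_data" +
  Prod :: "'o \<Rightarrow> 'o \<Rightarrow> 'o"
  pr1 :: "'o \<Rightarrow> 'o \<Rightarrow> 'm"
  pr2 :: "'o \<Rightarrow> 'o \<Rightarrow> 'm"

locale category_with_products = category S
  for S :: "('o, 'm, 'z) product_category_data_scheme" (structure) +
  assumes Prod_closed: "\<lbrakk>X \<in> Ob S; Y \<in> Ob S\<rbrakk> \<Longrightarrow> Prod S X Y \<in> Ob S"
    and pr1_Hom: "\<lbrakk>X \<in> Ob S; Y \<in> Ob S\<rbrakk> \<Longrightarrow> pr1 S X Y \<in> Hom S (Prod S X Y) X"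
    and pr2_Hom: "\<lbrakk>X \<in> Ob S; Y \<in> Ob S\<rbrakk> \<Longrightarrow> pr2 S X Y \<in> Hom S (Prod S X Y) Y"
    and Prod_universal: "\<lbrakk>f \<in> Hom S Z X; g \<in> Hom S Z Y\<rbrakk>
      \<Longrightarrow> \<exists>!h. h \<in> Hom S Z (Prod S X Y) \<and> pr1 S X Y \<cdot> h = f \<and> pr2 S X Y \<cdot> h = g"

definition prod_arrow :: "('o, 'm, 'z) product_category_data_scheme \<Rightarrow> 'm \<Rightarrow> 'm \<Rightarrow> 'm" where
  "prod_arrow S f1 f2 =
     (let T1 = Dom S f1; T2 = Dom S f2; S1 = Cod S f1; S2 = Cod S f2 in
      THE h. h \<in> Hom S (Prod S T1 T2) (Prod S S1 S2) \<and>
             pr1 S S1 S2 \<cdot>\<^bsub>S\<^esub> h = f1 \<cdot>\<^bsub>S\<^esub> pr1 S T1 T2 \<and>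
             pr2 S S1 S2 \<cdot>\<^bsub>S\<^esub> h = f2 \<cdot>\<^bsub>S\<^esub> pr2 S T1 T2)"

text \<open>\<open>cartesian_square C p z z' p'\<close>: the square
  \<open>p \<cdot> z' = z \<cdot> p'\<close> with \<open>p : P \<rightarrow> X\<close>, \<open>z : Z \<rightarrow> X\<close>, \<open>z' : Q \<rightarrow> P\<close>, \<open>p' : Q \<rightarrow> Z\<close> is Cartesian;
  thus \<open>p'\<close> is a base change of \<open>p\<close> along \<open>z\<close>, and \<open>z'\<close> one of \<open>z\<close> along \<open>p\<close>.\<close>

definition cartesian_square ::
  "('o, 'm, 'z) category_data_scheme \<Rightarrow> 'm \<Rightarrow> 'm \<Rightarrow> 'm \<Rightarrow> 'm \<Rightarrow> bool" where
  "cartesian_square C p z z' p' \<longleftrightarrow>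
     p \<in> Ar C \<and> z \<in> Ar C \<and> Cod C p = Cod C z \<and>
     z' \<in> Hom C (Dom C p') (Dom C p) \<and> p' \<in> Hom C (Dom C z') (Dom C z) \<and>
     p \<cdot>\<^bsub>C\<^esub> z' = z \<cdot>\<^bsub>C\<^esub> p' \<and>
     (\<forall>W u v. u \<in> Hom C W (Dom C p) \<and> v \<in> Hom C W (Dom C z) \<and> p \<cdot>\<^bsub>C\<^esub> u = z \<cdot>\<^bsub>C\<^esub> v \<longrightarrow>
        (\<exists>!h. h \<in> Hom C W (Dom C z') \<and> z' \<cdot>\<^bsub>C\<^esub> h = u \<and> p' \<cdot>\<^bsub>C\<^esub> h = v))"

text \<open>A subcategory with all objects is given by its set of arrows.  Since \<open>M\<close> contains all
  isomorphisms, it contains in particular all identities.\<close>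

definition wide_subcategory_with_isos :: "('o, 'm, 'z) category_data_scheme \<Rightarrow> 'm set \<Rightarrow> bool" where
  "wide_subcategory_with_isos C M \<longleftrightarrow>
     M \<subseteq> Ar C \<and>
     (\<forall>f\<in>M. \<forall>g\<in>M. Cod C f = Dom C g \<longrightarrow> g \<cdot>\<^bsub>C\<^esub> f \<in> M) \<and>
     (\<forall>f. is_iso C f \<longrightarrow> f \<in> M)"

locale base_category = category_with_products S
  for S :: "('o, 'm, 'z) product_category_data_scheme" (structure) +
  fixes sm cl :: "'m set"
  assumes sm_subcategory: "wide_subcategory_with_isos S sm"
    and cl_subcategory: "wide_subcategory_with_isos S cl"
    and fibered_product_exists:
      "\<lbrakk>p \<in> sm; f \<in> Ar S; Cod S f = Cod S p\<rbrakk> \<Longrightarrow> \<exists>f' p'. cartesian_square S p f f' p'"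
    and sm_base_change: "\<lbrakk>p \<in> sm; cartesian_square S p f f' p'\<rbrakk> \<Longrightarrow> p' \<in> sm"
    and cl_base_change: "\<lbrakk>p \<in> sm; z \<in> cl; cartesian_square S p z z' p'\<rbrakk> \<Longrightarrow> z' \<in> cl"
    and cl_cancel: "\<lbrakk>z \<in> Ar S; g \<in> Ar S; Cod S z = Dom S g; g \<cdot> z \<in> cl\<rbrakk> \<Longrightarrow> z \<in> cl"
    and sm_cl_factorization: "f \<in> Ar S \<Longrightarrow> \<exists>t\<in>cl. \<exists>p\<in>sm. Cod S t = Dom S p \<and> f = p \<cdot> t"


section \<open>Fibered categories and their morphisms\<close>

text \<open>\<open>conn H f g A : (g f)\<^sup>* A \<rightarrow> f\<^sup>* g\<^sup>* A\<close>.\<close>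

record ('o, 'm, 'a, 'b) fibered_data =
  fib :: "'o \<Rightarrow> ('a, 'b) category_data"
  pb :: "'m \<Rightarrow> ('a, 'b, 'a, 'b) functor_data"
  conn :: "'m \<Rightarrow> 'm \<Rightarrow> 'a \<Rightarrow> 'b"

locale fibered_category = category S
  for S :: "('o, 'm, 'z) category_data_scheme" (structure) +
  fixes H :: "('o, 'm, 'a, 'b) fibered_data"
  assumes fib_category: "X \<in> Ob S \<Longrightarrow> category (fib H X)"
    and pb_functor: "f \<in> Hom S T X \<Longrightarrow> category_functor (fib H X) (fib H T) (pb H f)"
    and pb_Ident_obj: "\<lbrakk>X \<in> Ob S; A \<in> Ob (fib H X)\<rbrakk> \<Longrightarrow> fobj (pb H (Ident S X)) A = A"
    and pb_Ident_arr: "\<lbrakk>X \<in> Ob S; a \<in> Ar (fib H X)\<rbrakk> \<Longrightarrow> farr (pb H (Ident S X)) a = a"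
    and conn_natural_iso: "\<lbrakk>f \<in> Hom S T X; g \<in> Hom S X Y\<rbrakk>
      \<Longrightarrow> natural_iso (fib H Y) (fib H T) (pb H (g \<cdot> f)) (pb H f \<circ>\<^sub>F pb H g) (conn H f g)"
    and conn_cocycle:
      "\<lbrakk>f \<in> Hom S T X; g \<in> Hom S X Y; h \<in> Hom S Y Z; A \<in> Ob (fib H Z)\<rbrakk>
       \<Longrightarrow> farr (pb H f) (conn H g h A) \<cdot>\<^bsub>fib H T\<^esub> conn H f (h \<cdot> g) A
         = conn H f g (fobj (pb H h) A) \<cdot>\<^bsub>fib H T\<^esub> conn H (g \<cdot> f) h A"

text \<open>\<open>\<theta> f A : f\<^sup>* (R\<^sub>X A) \<rightarrow> R\<^sub>T (f\<^sup>* A)\<close> for \<open>f : T \<rightarrow> X\<close>.  In \<open>theta_comp\<close> the identification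
  \<open>(g f)\<^sup>* = f\<^sup>* g\<^sup>*\<close> is made explicit by the connection isomorphisms of \<open>H1\<close> and \<open>H2\<close>.\<close>

locale fibered_morphism = H1: fibered_category S H1 + H2: fibered_category S H2
  for S :: "('o, 'm, 'z) category_data_scheme" (structure)
    and H1 :: "('o, 'm, 'a1, 'b1) fibered_data"
    and H2 :: "('o, 'm, 'a2, 'b2) fibered_data" +
  fixes R :: "'o \<Rightarrow> ('a1, 'b1, 'a2, 'b2) functor_data"
    and \<theta> :: "'m \<Rightarrow> 'a1 \<Rightarrow> 'b2"
  assumes R_functor: "X \<in> Ob S \<Longrightarrow> category_functor (fib H1 X) (fib H2 X) (R X)"
    and theta_natural_iso: "f \<in> Hom S T X
      \<Longrightarrow> natural_iso (fib H1 X) (fib H2 T) (pb H2 f \<circ>\<^sub>F R X) (R T \<circ>\<^sub>F pb H1 f) (\<theta> f)"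
    and theta_comp:
      "\<lbrakk>f \<in> Hom S T X; g \<in> Hom S X Y; A \<in> Ob (fib H1 Y)\<rbrakk>
       \<Longrightarrow> farr (R T) (conn H1 f g A) \<cdot>\<^bsub>fib H2 T\<^esub> \<theta> (g \<cdot> f) A
         = \<theta> f (fobj (pb H1 g) A) \<cdot>\<^bsub>fib H2 T\<^esub> farr (pb H2 f) (\<theta> g A)
             \<cdot>\<^bsub>fib H2 T\<^esub> conn H2 f g (fobj (R Y) A)"


section \<open>External tensor structures\<close>

text \<open>\<open>E X1 X2 : H(X1) \<times> H(X2) \<rightarrow> H(X1 \<times> X2)\<close> is the functor \<open>\<boxtimes>\<close>, and
  \<open>m f1 f2 (A1, A2) : f1\<^sup>* A1 \<boxtimes> f2\<^sup>* A2 \<rightarrow> (f1 \<times> f2)\<^sup>* (A1 \<boxtimes> A2)\<close>.\<close>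

locale external_tensor_structure = category_with_products S + fibered_category S H
  for S :: "('o, 'm, 'z) product_category_data_scheme" (structure)
    and H :: "('o, 'm, 'a, 'b) fibered_data" +
  fixes E :: "'o \<Rightarrow> 'o \<Rightarrow> ('a \<times> 'a, 'b \<times> 'b, 'a, 'b) functor_data"
    and m :: "'m \<Rightarrow> 'm \<Rightarrow> 'a \<times> 'a \<Rightarrow> 'b"
  assumes tensor_functor: "\<lbrakk>X1 \<in> Ob S; X2 \<in> Ob S\<rbrakk>
      \<Longrightarrow> category_functor (prod_category (fib H X1) (fib H X2)) (fib H (Prod S X1 X2)) (E X1 X2)"
    and m_natural_iso: "\<lbrakk>f1 \<in> Hom S T1 X1; f2 \<in> Hom S T2 X2\<rbrakk>
      \<Longrightarrow> natural_iso (prod_category (fib H X1) (fib H X2)) (fib H (Prod S T1 T2))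
            (E T1 T2 \<circ>\<^sub>F (pb H f1 \<times>\<^sub>F pb H f2)) (pb H (prod_arrow S f1 f2) \<circ>\<^sub>F E X1 X2) (m f1 f2)"
    and m_comp:
      "\<lbrakk>f1 \<in> Hom S T1 X1; g1 \<in> Hom S X1 Y1; f2 \<in> Hom S T2 X2; g2 \<in> Hom S X2 Y2;
        A1 \<in> Ob (fib H Y1); A2 \<in> Ob (fib H Y2)\<rbrakk>
       \<Longrightarrow> conn H (prod_arrow S f1 f2) (prod_arrow S g1 g2) (fobj (E Y1 Y2) (A1, A2))
             \<cdot>\<^bsub>fib H (Prod S T1 T2)\<^esub> m (g1 \<cdot> f1) (g2 \<cdot> f2) (A1, A2)
         = farr (pb H (prod_arrow S f1 f2)) (m g1 g2 (A1, A2))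
             \<cdot>\<^bsub>fib H (Prod S T1 T2)\<^esub> m f1 f2 (fobj (pb H g1) A1, fobj (pb H g2) A2)
             \<cdot>\<^bsub>fib H (Prod S T1 T2)\<^esub> farr (E T1 T2) (conn H f1 g1 A1, conn H f2 g2 A2)"

text \<open>\<open>M\<close> is the set of arrows of the subcategory \<open>S'\<close> of \<open>S\<close>.  Only the values of \<open>m1\<close> and \<open>m2\<close>
  at pairs of arrows of \<open>S'\<close> enter, whereas \<open>f1 \<times> f2\<close> is formed in \<open>S\<close>, where \<open>H1\<close>, \<open>H2\<close>
  and \<open>\<theta>\<close> are defined.\<close>

definition external_tensor_structure_on_morphism ::
  "('o, 'm, 'z) product_category_data_scheme \<Rightarrow> 'm set
   \<Rightarrow> ('o, 'm, 'a1, 'b1) fibered_data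
   \<Rightarrow> ('o \<Rightarrow> 'o \<Rightarrow> ('a1 \<times> 'a1, 'b1 \<times> 'b1, 'a1, 'b1) functor_data)
   \<Rightarrow> ('m \<Rightarrow> 'm \<Rightarrow> 'a1 \<times> 'a1 \<Rightarrow> 'b1)
   \<Rightarrow> ('o, 'm, 'a2, 'b2) fibered_data
   \<Rightarrow> ('o \<Rightarrow> 'o \<Rightarrow> ('a2 \<times> 'a2, 'b2 \<times> 'b2, 'a2, 'b2) functor_data)
   \<Rightarrow> ('m \<Rightarrow> 'm \<Rightarrow> 'a2 \<times> 'a2 \<Rightarrow> 'b2)
   \<Rightarrow> ('o \<Rightarrow> ('a1, 'b1, 'a2, 'b2) functor_data) \<Rightarrow> ('m \<Rightarrow> 'a1 \<Rightarrow> 'b2)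
   \<Rightarrow> ('o \<Rightarrow> 'o \<Rightarrow> 'a1 \<times> 'a1 \<Rightarrow> 'b2) \<Rightarrow> bool" where
  "external_tensor_structure_on_morphism S M H1 E1 m1 H2 E2 m2 R \<theta> \<rho> \<longleftrightarrow>
     (\<forall>X1\<in>Ob S. \<forall>X2\<in>Ob S.
        natural_iso (prod_category (fib H1 X1) (fib H1 X2)) (fib H2 (Prod S X1 X2))
          (E2 X1 X2 \<circ>\<^sub>F (R X1 \<times>\<^sub>F R X2)) (R (Prod S X1 X2) \<circ>\<^sub>F E1 X1 X2) (\<rho> X1 X2)) \<and>
     (\<forall>T1 X1 T2 X2 f1 f2 A1 A2.
        f1 \<in> M \<inter> Hom S T1 X1 \<and> f2 \<in> M \<inter> Hom S T2 X2 \<and>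
        A1 \<in> Ob (fib H1 X1) \<and> A2 \<in> Ob (fib H1 X2) \<longrightarrow>
        \<theta> (prod_arrow S f1 f2) (fobj (E1 X1 X2) (A1, A2))
          \<cdot>\<^bsub>fib H2 (Prod S T1 T2)\<^esub> farr (pb H2 (prod_arrow S f1 f2)) (\<rho> X1 X2 (A1, A2))
          \<cdot>\<^bsub>fib H2 (Prod S T1 T2)\<^esub> m2 f1 f2 (fobj (R X1) A1, fobj (R X2) A2)
        = farr (R (Prod S T1 T2)) (m1 f1 f2 (A1, A2))
          \<cdot>\<^bsub>fib H2 (Prod S T1 T2)\<^esub> \<rho> T1 T2 (fobj (pb H1 f1) A1, fobj (pb H1 f2) A2)
          \<cdot>\<^bsub>fib H2 (Prod S T1 T2)\<^esub> farr (E2 T1 T2) (\<theta> f1 A1, \<theta> f2 A2))"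

text \<open>The two families of a skeleton are compared at arguments in their domains only, since
  elsewhere their values are arbitrary.\<close>

definition external_tensor_skeleton_on_morphism ::
  "('o, 'm, 'z) product_category_data_scheme \<Rightarrow> 'm set \<Rightarrow> 'm set
   \<Rightarrow> ('o, 'm, 'a1, 'b1) fibered_data
   \<Rightarrow> ('o \<Rightarrow> 'o \<Rightarrow> ('a1 \<times> 'a1, 'b1 \<times> 'b1, 'a1, 'b1) functor_data)
   \<Rightarrow> ('m \<Rightarrow> 'm \<Rightarrow> 'a1 \<times> 'a1 \<Rightarrow> 'b1) \<Rightarrow> ('m \<Rightarrow> 'm \<Rightarrow> 'a1 \<times> 'a1 \<Rightarrow> 'b1)
   \<Rightarrow> ('o, 'm, 'a2, 'b2) fibered_data
   \<Rightarrow> ('o \<Rightarrow> 'o \<Rightarrow> ('a2 \<times> 'a2, 'b2 \<times> 'b2, 'a2, 'b2) functor_data)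
   \<Rightarrow> ('m \<Rightarrow> 'm \<Rightarrow> 'a2 \<times> 'a2 \<Rightarrow> 'b2) \<Rightarrow> ('m \<Rightarrow> 'm \<Rightarrow> 'a2 \<times> 'a2 \<Rightarrow> 'b2)
   \<Rightarrow> ('o \<Rightarrow> ('a1, 'b1, 'a2, 'b2) functor_data) \<Rightarrow> ('m \<Rightarrow> 'a1 \<Rightarrow> 'b2)
   \<Rightarrow> ('o \<Rightarrow> 'o \<Rightarrow> 'a1 \<times> 'a1 \<Rightarrow> 'b2) \<Rightarrow> ('o \<Rightarrow> 'o \<Rightarrow> 'a1 \<times> 'a1 \<Rightarrow> 'b2) \<Rightarrow> bool" where
  "external_tensor_skeleton_on_morphism S sm cl H1 E1 m1sm m1cl H2 E2 m2sm m2cl R \<theta> \<rho>sm \<rho>cl \<longleftrightarrow>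
     external_tensor_structure_on_morphism S sm H1 E1 m1sm H2 E2 m2sm R \<theta> \<rho>sm \<and>
     external_tensor_structure_on_morphism S cl H1 E1 m1cl H2 E2 m2cl R \<theta> \<rho>cl \<and>
     (\<forall>X1\<in>Ob S. \<forall>X2\<in>Ob S. \<forall>A1\<in>Ob (fib H1 X1). \<forall>A2\<in>Ob (fib H1 X2).
        \<rho>sm X1 X2 (A1, A2) = \<rho>cl X1 X2 (A1, A2))"

definition restrict_m :: "'m set \<Rightarrow> ('m \<Rightarrow> 'm \<Rightarrow> 'c) \<Rightarrow> 'm \<Rightarrow> 'm \<Rightarrow> 'c" where
  "restrict_m M m = (\<lambda>f1 f2. if f1 \<in> M \<and> f2 \<in> M then m f1 f2 else undefined)"

end

theory Submission
  imports Defs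
begin

text \<open>
  A tensor structure on \<open>R\<close> restricts to the two subcategories, so only the passage from the
  skeleton to the structure needs an argument.  By the factorization axiom, a pair of arrows
  \<open>(f1, f2)\<close> of the base is a pair of closed immersions followed by a pair of smooth arrows, and the
  same family \<open>\<rho>\<close> is compatible with both pairs.  It therefore suffices that compatibility of
  \<open>\<rho>\<close> with pairs of arrows is stable under componentwise composition
  (\<open>rho_compatible_Comp\<close>).  This is a diagram chase: each of \<open>m1\<close>, \<open>m2\<close> and \<open>\<theta>\<close>
  has its cocycle condition, which expresses its value at a composite \<open>g f\<close> through the values at
  \<open>f\<close> and \<open>g\<close>, up to connection isomorphisms.  Substituting these conditions, the diagram for
  \<open>(g1 f1, g2 f2)\<close> becomes the image under \<open>(f1 \<times> f2)\<^sup>*\<close> of the one for \<open>(g1, g2)\<close> pasted with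
  the one for \<open>(f1, f2)\<close>, all other cells being naturality squares.  The chase yields
  the wanted identity after composition with \<open>R (conn H1 (f1 \<times> f2) (g1 \<times> g2) _)\<close>, which is an
  isomorphism and can be cancelled.
\<close>

section \<open>Composition in categories\<close>

lemma HomD: "f \<in> Hom C X Y \<Longrightarrow> f \<in> Ar C \<and> Dom C f = X \<and> Cod C f = Y"
  by (simp add: Hom_def)

context category
begin

text \<open>With sources and targets as equations instead of parameters of \<open>Hom\<close>, the side
  conditions of associativity can be discharged by rewriting; right-nested
  composites are then normal forms.\<close>

lemma Comp_in_Ar:
  "\<lbrakk>f \<in> Ar C; g \<in> Ar C; Cod C f = Dom C g\<rbrakk>
   \<Longrightarrow> g \<cdot> f \<in> Ar C \<and> Dom C (g \<cdot> f) = Dom C f \<and> Cod C (g \<cdot> f) = Cod C g"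
  using Comp_Hom[of f "Dom C f" "Cod C f" g "Cod C g"] by (simp add: Hom_def)

lemma Comp_assoc_right:
  "\<lbrakk>f \<in> Ar C; g \<in> Ar C; h \<in> Ar C; Cod C f = Dom C g; Cod C g = Dom C h\<rbrakk>
   \<Longrightarrow> (h \<cdot> g) \<cdot> f = h \<cdot> (g \<cdot> f)"
  using Comp_assoc[of f "Dom C f" "Cod C f" g "Cod C g" h "Cod C h"] by (simp add: Hom_def)

lemma iso_cancel_left:
  assumes k: "is_iso C k" "k \<in> Hom C Y Z"
    and u: "u \<in> Hom C X Y" and v: "v \<in> Hom C X Y"
    and eq: "k \<cdot> u = k \<cdot> v"
  shows "u = v"
proof -
  obtain l where l: "l \<in> Hom C Z Y" "l \<cdot> k = Ident C Y"
    using k unfolding is_iso_def by (auto simp: Hom_def)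
  have "(l \<cdot> k) \<cdot> u = (l \<cdot> k) \<cdot> v"
    using Comp_assoc[OF u k(2) l(1)] Comp_assoc[OF v k(2) l(1)] eq by simp
  then show ?thesis
    using l(2) Comp_Ident_left[OF u] Comp_Ident_left[OF v] by simp
qed

end

lemma (in category_functor) preserves_iso:
  assumes "is_iso C f" shows "is_iso D (farr F f)"
proof -
  obtain g where f: "f \<in> Hom C (Dom C f) (Cod C f)" and g: "g \<in> Hom C (Cod C f) (Dom C f)"
    and inv: "g \<cdot>\<^bsub>C\<^esub> f = Ident C (Dom C f)" "f \<cdot>\<^bsub>C\<^esub> g = Ident C (Cod C f)"
    using assms unfolding is_iso_def by (auto simp: Hom_def)
  have ob: "Dom C f \<in> Ob C" "Cod C f \<in> Ob C"
    using f source.Dom_closed source.Cod_closed by (auto simp: Hom_def)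
  show ?thesis
    unfolding is_iso_def
    using farr_Hom[OF f] farr_Hom[OF g] farr_Comp[OF f g] farr_Comp[OF g f] inv ob
    by (auto simp: Hom_def farr_Ident intro!: bexI[of _ "farr F g"])
qed

section \<open>Products of arrows in the base\<close>

context category_with_products
begin

lemma prod_arrow_characterization:
  assumes f1: "f1 \<in> Hom S T1 X1" and f2: "f2 \<in> Hom S T2 X2"
  shows "\<exists>!h. h \<in> Hom S (Prod S T1 T2) (Prod S X1 X2) \<and>
           pr1 S X1 X2 \<cdot> h = f1 \<cdot> pr1 S T1 T2 \<and> pr2 S X1 X2 \<cdot> h = f2 \<cdot> pr2 S T1 T2"
    and "prod_arrow S f1 f2 \<in> Hom S (Prod S T1 T2) (Prod S X1 X2) \<and>
           pr1 S X1 X2 \<cdot> prod_arrow S f1 f2 = f1 \<cdot> pr1 S T1 T2 \<and>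
           pr2 S X1 X2 \<cdot> prod_arrow S f1 f2 = f2 \<cdot> pr2 S T1 T2"
proof -
  have ob: "T1 \<in> Ob S" "T2 \<in> Ob S"
    using f1 f2 Dom_closed by (auto simp: Hom_def)
  show ex1: "\<exists>!h. h \<in> Hom S (Prod S T1 T2) (Prod S X1 X2) \<and>
           pr1 S X1 X2 \<cdot> h = f1 \<cdot> pr1 S T1 T2 \<and> pr2 S X1 X2 \<cdot> h = f2 \<cdot> pr2 S T1 T2"
    using Prod_universal[OF Comp_Hom[OF pr1_Hom[OF ob] f1] Comp_Hom[OF pr2_Hom[OF ob] f2]] .
  show "prod_arrow S f1 f2 \<in> Hom S (Prod S T1 T2) (Prod S X1 X2) \<and>
           pr1 S X1 X2 \<cdot> prod_arrow S f1 f2 = f1 \<cdot> pr1 S T1 T2 \<and>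
           pr2 S X1 X2 \<cdot> prod_arrow S f1 f2 = f2 \<cdot> pr2 S T1 T2"
    using theI'[OF ex1] HomD[OF f1] HomD[OF f2] by (simp add: prod_arrow_def Let_def)
qed

lemma prod_arrow_Hom:
  "\<lbrakk>f1 \<in> Hom S T1 X1; f2 \<in> Hom S T2 X2\<rbrakk>
   \<Longrightarrow> prod_arrow S f1 f2 \<in> Hom S (Prod S T1 T2) (Prod S X1 X2)"
  using prod_arrow_characterization(2) by blast

lemma prod_arrow_Comp:
  assumes f: "f1 \<in> Hom S T1 X1" "f2 \<in> Hom S T2 X2"
    and g: "g1 \<in> Hom S X1 Y1" "g2 \<in> Hom S X2 Y2"
  shows "prod_arrow S (g1 \<cdot> f1) (g2 \<cdot> f2) = prod_arrow S g1 g2 \<cdot> prod_arrow S f1 f2"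
proof -
  have ob: "T1 \<in> Ob S" "T2 \<in> Ob S" "X1 \<in> Ob S" "X2 \<in> Ob S" "Y1 \<in> Ob S" "Y2 \<in> Ob S"
    using f g Dom_closed Cod_closed by (auto simp: Hom_def)
  note F = prod_arrow_characterization(2)[OF f] and G = prod_arrow_characterization(2)[OF g]
  note gf = Comp_Hom[OF f(1) g(1)] Comp_Hom[OF f(2) g(2)]
  note typing = HomD[OF pr1_Hom[OF ob(1,2)]] HomD[OF pr2_Hom[OF ob(1,2)]]
    HomD[OF pr1_Hom[OF ob(3,4)]] HomD[OF pr2_Hom[OF ob(3,4)]]
    HomD[OF pr1_Hom[OF ob(5,6)]] HomD[OF pr2_Hom[OF ob(5,6)]]
    HomD[OF f(1)] HomD[OF f(2)] HomD[OF g(1)] HomD[OF g(2)]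
    HomD[OF prod_arrow_Hom[OF f]] HomD[OF prod_arrow_Hom[OF g]]
  let ?F = "prod_arrow S f1 f2" and ?G = "prod_arrow S g1 g2"
  have "pr1 S Y1 Y2 \<cdot> (?G \<cdot> ?F) = (pr1 S Y1 Y2 \<cdot> ?G) \<cdot> ?F"
    "pr2 S Y1 Y2 \<cdot> (?G \<cdot> ?F) = (pr2 S Y1 Y2 \<cdot> ?G) \<cdot> ?F"
    using typing by (simp_all add: Comp_assoc_right)
  then have "pr1 S Y1 Y2 \<cdot> (?G \<cdot> ?F) = (g1 \<cdot> f1) \<cdot> pr1 S T1 T2"
    "pr2 S Y1 Y2 \<cdot> (?G \<cdot> ?F) = (g2 \<cdot> f2) \<cdot> pr2 S T1 T2"
    using F G typing by (simp_all add: Comp_assoc_right)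
  moreover have "?G \<cdot> ?F \<in> Hom S (Prod S T1 T2) (Prod S Y1 Y2)"
    using F G Comp_Hom by blast
  ultimately show ?thesis
    using prod_arrow_characterization[OF gf] by blast
qed

end

section \<open>The structure maps in components\<close>

context fibered_category
begin

lemma pb_obj: "\<lbrakk>f \<in> Hom S T X; A \<in> Ob (fib H X)\<rbrakk> \<Longrightarrow> fobj (pb H f) A \<in> Ob (fib H T)"
  using category_functor.fobj_closed[OF pb_functor] .

lemma pb_arr_Hom:
  "\<lbrakk>f \<in> Hom S T X; a \<in> Hom (fib H X) A B\<rbrakk>
   \<Longrightarrow> farr (pb H f) a \<in> Hom (fib H T) (fobj (pb H f) A) (fobj (pb H f) B)"
  using category_functor.farr_Hom[OF pb_functor] .

lemma pb_arr_Comp: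
  "\<lbrakk>f \<in> Hom S T X; a \<in> Hom (fib H X) A B; b \<in> Hom (fib H X) B E\<rbrakk>
   \<Longrightarrow> farr (pb H f) (b \<cdot>\<^bsub>fib H X\<^esub> a) = farr (pb H f) b \<cdot>\<^bsub>fib H T\<^esub> farr (pb H f) a"
  using category_functor.farr_Comp[OF pb_functor] .

lemma conn_Hom:
  "\<lbrakk>f \<in> Hom S T X; g \<in> Hom S X Y; A \<in> Ob (fib H Y)\<rbrakk>
   \<Longrightarrow> conn H f g A \<in> Hom (fib H T) (fobj (pb H (g \<cdot> f)) A) (fobj (pb H f) (fobj (pb H g) A))"
  using natural_iso.component_Hom[OF conn_natural_iso] by (fastforce simp: comp_functor_def)

lemma conn_iso:
  "\<lbrakk>f \<in> Hom S T X; g \<in> Hom S X Y; A \<in> Ob (fib H Y)\<rbrakk> \<Longrightarrow> is_iso (fib H T) (conn H f g A)"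
  using natural_iso.component_iso[OF conn_natural_iso] .

lemma conn_naturality:
  assumes "f \<in> Hom S T X" "g \<in> Hom S X Y" "a \<in> Hom (fib H Y) A B"
  shows "conn H f g B \<cdot>\<^bsub>fib H T\<^esub> farr (pb H (g \<cdot> f)) a
     = farr (pb H f) (farr (pb H g) a) \<cdot>\<^bsub>fib H T\<^esub> conn H f g A"
  using natural_iso.naturality[OF conn_natural_iso[OF assms(1,2)] assms(3)]
  by (simp add: comp_functor_def)

end

context fibered_morphism
begin

lemma R_obj: "\<lbrakk>X \<in> Ob S; A \<in> Ob (fib H1 X)\<rbrakk> \<Longrightarrow> fobj (R X) A \<in> Ob (fib H2 X)"
  using category_functor.fobj_closed[OF R_functor] .

lemma R_arr_Hom:
  "\<lbrakk>X \<in> Ob S; a \<in> Hom (fib H1 X) A B\<rbrakk> \<Longrightarrow> farr (R X) a \<in> Hom (fib H2 X) (fobj (R X) A) (fobj (R X) B)"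
  using category_functor.farr_Hom[OF R_functor] .

lemma R_arr_Comp:
  "\<lbrakk>X \<in> Ob S; a \<in> Hom (fib H1 X) A B; b \<in> Hom (fib H1 X) B E\<rbrakk>
   \<Longrightarrow> farr (R X) (b \<cdot>\<^bsub>fib H1 X\<^esub> a) = farr (R X) b \<cdot>\<^bsub>fib H2 X\<^esub> farr (R X) a"
  using category_functor.farr_Comp[OF R_functor] .

lemma theta_Hom:
  "\<lbrakk>f \<in> Hom S T X; A \<in> Ob (fib H1 X)\<rbrakk>
   \<Longrightarrow> \<theta> f A \<in> Hom (fib H2 T) (fobj (pb H2 f) (fobj (R X) A)) (fobj (R T) (fobj (pb H1 f) A))"
  using natural_iso.component_Hom[OF theta_natural_iso] by (fastforce simp: comp_functor_def)

lemma theta_naturality: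
  assumes "f \<in> Hom S T X" "a \<in> Hom (fib H1 X) A B"
  shows "\<theta> f B \<cdot>\<^bsub>fib H2 T\<^esub> farr (pb H2 f) (farr (R X) a)
     = farr (R T) (farr (pb H1 f) a) \<cdot>\<^bsub>fib H2 T\<^esub> \<theta> f A"
  using natural_iso.naturality[OF theta_natural_iso[OF assms(1)] assms(2)]
  by (simp add: comp_functor_def)

end

lemma Ob_prod_category: "(A, B) \<in> Ob (prod_category C D) \<longleftrightarrow> A \<in> Ob C \<and> B \<in> Ob D"
  by (simp add: prod_category_def)

lemma Hom_prod_category:
  "(a, b) \<in> Hom (prod_category C D) (A, B) (A', B') \<longleftrightarrow> a \<in> Hom C A A' \<and> b \<in> Hom D B B'"
  by (auto simp: prod_category_def Hom_def)

context external_tensor_structure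
begin

lemma tensor_obj:
  "\<lbrakk>X1 \<in> Ob S; X2 \<in> Ob S; A1 \<in> Ob (fib H X1); A2 \<in> Ob (fib H X2)\<rbrakk>
   \<Longrightarrow> fobj (E X1 X2) (A1, A2) \<in> Ob (fib H (Prod S X1 X2))"
  using category_functor.fobj_closed[OF tensor_functor] by (simp add: Ob_prod_category)

lemma tensor_arr_Hom:
  "\<lbrakk>X1 \<in> Ob S; X2 \<in> Ob S; a1 \<in> Hom (fib H X1) A1 B1; a2 \<in> Hom (fib H X2) A2 B2\<rbrakk>
   \<Longrightarrow> farr (E X1 X2) (a1, a2)
        \<in> Hom (fib H (Prod S X1 X2)) (fobj (E X1 X2) (A1, A2)) (fobj (E X1 X2) (B1, B2))"
  using category_functor.farr_Hom[OF tensor_functor] by (simp add: Hom_prod_category)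

lemma tensor_arr_Comp:
  assumes "X1 \<in> Ob S" "X2 \<in> Ob S"
    and "a1 \<in> Hom (fib H X1) A1 B1" "a2 \<in> Hom (fib H X2) A2 B2"
    and "b1 \<in> Hom (fib H X1) B1 C1" "b2 \<in> Hom (fib H X2) B2 C2"
  shows "farr (E X1 X2) (b1 \<cdot>\<^bsub>fib H X1\<^esub> a1, b2 \<cdot>\<^bsub>fib H X2\<^esub> a2)
     = farr (E X1 X2) (b1, b2) \<cdot>\<^bsub>fib H (Prod S X1 X2)\<^esub> farr (E X1 X2) (a1, a2)"
  using category_functor.farr_Comp[OF tensor_functor[OF assms(1,2)],
      of "(a1, a2)" "(A1, A2)" "(B1, B2)" "(b1, b2)" "(C1, C2)"] assms
  unfolding Hom_prod_category by (simp add: prod_category_def)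

lemma m_Hom:
  assumes "f1 \<in> Hom S T1 X1" "f2 \<in> Hom S T2 X2" "A1 \<in> Ob (fib H X1)" "A2 \<in> Ob (fib H X2)"
  shows "m f1 f2 (A1, A2) \<in> Hom (fib H (Prod S T1 T2))
      (fobj (E T1 T2) (fobj (pb H f1) A1, fobj (pb H f2) A2))
      (fobj (pb H (prod_arrow S f1 f2)) (fobj (E X1 X2) (A1, A2)))"
  using natural_iso.component_Hom[OF m_natural_iso[OF assms(1,2)], of "(A1, A2)"] assms(3,4)
  by (simp add: Ob_prod_category comp_functor_def prod_functor_def)

lemma m_naturality:
  assumes "f1 \<in> Hom S T1 X1" "f2 \<in> Hom S T2 X2"
    and "a1 \<in> Hom (fib H X1) A1 B1" "a2 \<in> Hom (fib H X2) A2 B2"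
  shows "farr (pb H (prod_arrow S f1 f2)) (farr (E X1 X2) (a1, a2))
       \<cdot>\<^bsub>fib H (Prod S T1 T2)\<^esub> m f1 f2 (A1, A2)
     = m f1 f2 (B1, B2)
       \<cdot>\<^bsub>fib H (Prod S T1 T2)\<^esub> farr (E T1 T2) (farr (pb H f1) a1, farr (pb H f2) a2)"
  using natural_iso.naturality[OF m_natural_iso[OF assms(1,2)], of "(a1, a2)" "(A1, A2)" "(B1, B2)"]
    assms(3,4)
  by (simp add: Hom_prod_category comp_functor_def prod_functor_def)

end

section \<open>Compatible pairs are closed under composition\<close>

locale tensor_comparison =
  fibered_morphism S H1 H2 R \<theta> +
  T1: external_tensor_structure S H1 E1 m1 +
  T2: external_tensor_structure S H2 E2 m2
  for S :: "('o, 'm, 'z) product_category_data_scheme" (structure)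
    and H1 :: "('o, 'm, 'a1, 'b1) fibered_data"
    and E1 m1
    and H2 :: "('o, 'm, 'a2, 'b2) fibered_data"
    and E2 m2 R \<theta> +
  fixes \<rho> :: "'o \<Rightarrow> 'o \<Rightarrow> 'a1 \<times> 'a1 \<Rightarrow> 'b2"
  assumes rho_natural_iso: "\<lbrakk>X1 \<in> Ob S; X2 \<in> Ob S\<rbrakk>
      \<Longrightarrow> natural_iso (prod_category (fib H1 X1) (fib H1 X2)) (fib H2 (Prod S X1 X2))
            (E2 X1 X2 \<circ>\<^sub>F (R X1 \<times>\<^sub>F R X2)) (R (Prod S X1 X2) \<circ>\<^sub>F E1 X1 X2) (\<rho> X1 X2)"
begin

lemma rho_Hom:
  assumes "X1 \<in> Ob S" "X2 \<in> Ob S" "A1 \<in> Ob (fib H1 X1)" "A2 \<in> Ob (fib H1 X2)"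
  shows "\<rho> X1 X2 (A1, A2) \<in> Hom (fib H2 (Prod S X1 X2))
      (fobj (E2 X1 X2) (fobj (R X1) A1, fobj (R X2) A2))
      (fobj (R (Prod S X1 X2)) (fobj (E1 X1 X2) (A1, A2)))"
  using natural_iso.component_Hom[OF rho_natural_iso[OF assms(1,2)], of "(A1, A2)"] assms(3,4)
  by (simp add: Ob_prod_category comp_functor_def prod_functor_def)

lemma rho_naturality:
  assumes "X1 \<in> Ob S" "X2 \<in> Ob S"
    and "a1 \<in> Hom (fib H1 X1) A1 B1" "a2 \<in> Hom (fib H1 X2) A2 B2"
  shows "farr (R (Prod S X1 X2)) (farr (E1 X1 X2) (a1, a2))
       \<cdot>\<^bsub>fib H2 (Prod S X1 X2)\<^esub> \<rho> X1 X2 (A1, A2)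
     = \<rho> X1 X2 (B1, B2)
       \<cdot>\<^bsub>fib H2 (Prod S X1 X2)\<^esub> farr (E2 X1 X2) (farr (R X1) a1, farr (R X2) a2)"
  using natural_iso.naturality[OF rho_natural_iso[OF assms(1,2)], of "(a1, a2)" "(A1, A2)" "(B1, B2)"]
    assms(3,4)
  by (simp add: Hom_prod_category comp_functor_def prod_functor_def)

text \<open>Sources and targets are read off from the arrows, so that the axiom for a pair becomes a property of
  the pair alone, whatever subcategory it is taken in.\<close>

definition rho_compatible :: "'m \<Rightarrow> 'm \<Rightarrow> bool" where
  "rho_compatible f1 f2 \<longleftrightarrow>
     (\<forall>A1 \<in> Ob (fib H1 (Cod S f1)). \<forall>A2 \<in> Ob (fib H1 (Cod S f2)).
        let T1 = Dom S f1; T2 = Dom S f2; X1 = Cod S f1; X2 = Cod S f2 in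
        \<theta> (prod_arrow S f1 f2) (fobj (E1 X1 X2) (A1, A2))
          \<cdot>\<^bsub>fib H2 (Prod S T1 T2)\<^esub> farr (pb H2 (prod_arrow S f1 f2)) (\<rho> X1 X2 (A1, A2))
          \<cdot>\<^bsub>fib H2 (Prod S T1 T2)\<^esub> m2 f1 f2 (fobj (R X1) A1, fobj (R X2) A2)
        = farr (R (Prod S T1 T2)) (m1 f1 f2 (A1, A2))
          \<cdot>\<^bsub>fib H2 (Prod S T1 T2)\<^esub> \<rho> T1 T2 (fobj (pb H1 f1) A1, fobj (pb H1 f2) A2)
          \<cdot>\<^bsub>fib H2 (Prod S T1 T2)\<^esub> farr (E2 T1 T2) (\<theta> f1 A1, \<theta> f2 A2))"

text \<open>Write \<open>F = f1 \<times> f2\<close> and \<open>G = g1 \<times> g2\<close>.  The cocycle conditions cut the diagram for the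
  composites into \<open>F\<^sup>*\<close> of the diagram for \<open>(g1, g2)\<close> and the diagram for \<open>(f1, f2)\<close> at the
  pulled back objects.  The remaining cells are naturality squares: of the connection isomorphisms
  against \<open>\<rho>\<close>, of \<open>m2\<close> against \<open>\<theta>\<close>, of \<open>\<theta>\<close> against \<open>m1\<close>, and of \<open>\<rho>\<close> against the connection
  isomorphisms of \<open>H1\<close>.  All of this takes place in the fiber \<open>D\<close> of \<open>H2\<close> over \<open>T1 \<times> T2\<close>.

  The arrows of a diagram are called \<open>t\<close> (\<open>\<theta>\<close> at the product), \<open>r\<close> (\<open>\<rho>\<close> pulled back), \<open>n\<close> (\<open>m2\<close>),
  \<open>l\<close> (\<open>m1\<close> under \<open>R\<close>), \<open>s\<close> (\<open>\<rho>\<close> at pulled back objects), \<open>e\<close> (\<open>\<theta> \<boxtimes> \<theta>\<close>); those with \<open>k\<close> come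
  from connection isomorphisms, and a prime marks an application of \<open>F\<^sup>*\<close> in \<open>H2\<close>.\<close>

lemma rho_compatible_Comp:
  assumes f: "f1 \<in> Hom S T1 X1" "f2 \<in> Hom S T2 X2"
    and g: "g1 \<in> Hom S X1 Y1" "g2 \<in> Hom S X2 Y2"
    and compat_f: "rho_compatible f1 f2" and compat_g: "rho_compatible g1 g2"
  shows "rho_compatible (g1 \<cdot> f1) (g2 \<cdot> f2)"
proof -
  let ?T = "Prod S T1 T2" and ?X = "Prod S X1 X2" and ?Y = "Prod S Y1 Y2"
  define D where "D = fib H2 ?T"
  define F where "F = prod_arrow S f1 f2"
  define G where "G = prod_arrow S g1 g2"
  have ob: "T1 \<in> Ob S" "T2 \<in> Ob S" "X1 \<in> Ob S" "X2 \<in> Ob S" "Y1 \<in> Ob S" "Y2 \<in> Ob S"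
    using f g H1.Dom_closed H1.Cod_closed by (auto simp: Hom_def)
  have obP: "?T \<in> Ob S" "?X \<in> Ob S" "?Y \<in> Ob S"
    using ob T1.Prod_closed by auto
  have F: "F \<in> Hom S ?T ?X" and G: "G \<in> Hom S ?X ?Y"
    unfolding F_def G_def using f g T1.prod_arrow_Hom by auto
  have GF: "prod_arrow S (g1 \<cdot> f1) (g2 \<cdot> f2) = G \<cdot> F"
    unfolding F_def G_def using T1.prod_arrow_Comp[OF f g] .
  note gf = H1.Comp_Hom[OF f(1) g(1)] H1.Comp_Hom[OF f(2) g(2)]
  note GF_Hom = H1.Comp_Hom[OF F G]
  interpret D: category D
    unfolding D_def using H2.fib_category obP(1) .
  note D = D_def[symmetric]
  have eq: "\<theta> (G \<cdot> F) (fobj (E1 Y1 Y2) (A1, A2))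
          \<cdot>\<^bsub>D\<^esub> farr (pb H2 (G \<cdot> F)) (\<rho> Y1 Y2 (A1, A2))
          \<cdot>\<^bsub>D\<^esub> m2 (g1 \<cdot> f1) (g2 \<cdot> f2) (fobj (R Y1) A1, fobj (R Y2) A2)
        = farr (R ?T) (m1 (g1 \<cdot> f1) (g2 \<cdot> f2) (A1, A2))
          \<cdot>\<^bsub>D\<^esub> \<rho> T1 T2 (fobj (pb H1 (g1 \<cdot> f1)) A1, fobj (pb H1 (g2 \<cdot> f2)) A2)
          \<cdot>\<^bsub>D\<^esub> farr (E2 T1 T2) (\<theta> (g1 \<cdot> f1) A1, \<theta> (g2 \<cdot> f2) A2)"
    if A: "A1 \<in> Ob (fib H1 Y1)" "A2 \<in> Ob (fib H1 Y2)" for A1 A2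
  proof -
    let ?A = "fobj (E1 Y1 Y2) (A1, A2)"
    let ?R1 = "fobj (R Y1) A1" and ?R2 = "fobj (R Y2) A2"
    let ?B1 = "fobj (pb H1 g1) A1" and ?B2 = "fobj (pb H1 g2) A2"
    let ?B = "fobj (E1 X1 X2) (?B1, ?B2)"
    let ?C1 = "fobj (pb H2 g1) ?R1" and ?C2 = "fobj (pb H2 g2) ?R2"

    have R12: "?R1 \<in> Ob (fib H2 Y1)" "?R2 \<in> Ob (fib H2 Y2)"
      using R_obj ob A by auto
    have B12: "?B1 \<in> Ob (fib H1 X1)" "?B2 \<in> Ob (fib H1 X2)"
      using H1.pb_obj g A by auto
    have C12: "?C1 \<in> Ob (fib H2 X1)" "?C2 \<in> Ob (fib H2 X2)"
      using H2.pb_obj g R12 by auto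
    have A': "?A \<in> Ob (fib H1 ?Y)"
      using T1.tensor_obj ob A by auto
    have B': "?B \<in> Ob (fib H1 ?X)"
      using T1.tensor_obj ob B12 by auto
    have GA: "fobj (pb H1 G) ?A \<in> Ob (fib H1 ?X)"
      using H1.pb_obj G A' by auto
    have RA': "fobj (R ?Y) ?A \<in> Ob (fib H2 ?Y)"
      using R_obj obP A' by auto
    have RR: "fobj (E2 Y1 Y2) (?R1, ?R2) \<in> Ob (fib H2 ?Y)"
      using T2.tensor_obj ob R12 by auto

    \<comment> \<open>The diagram for \<open>(g1 f1, g2 f2)\<close>.\<close>
    define t where "t = \<theta> (G \<cdot> F) ?A"
    define r where "r = farr (pb H2 (G \<cdot> F)) (\<rho> Y1 Y2 (A1, A2))"
    define n where "n = m2 (g1 \<cdot> f1) (g2 \<cdot> f2) (?R1, ?R2)"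
    define l where "l = farr (R ?T) (m1 (g1 \<cdot> f1) (g2 \<cdot> f2) (A1, A2))"
    define s where "s = \<rho> T1 T2 (fobj (pb H1 (g1 \<cdot> f1)) A1, fobj (pb H1 (g2 \<cdot> f2)) A2)"
    define e where "e = farr (E2 T1 T2) (\<theta> (g1 \<cdot> f1) A1, \<theta> (g2 \<cdot> f2) A2)"
    \<comment> \<open>The pullback along \<open>F\<close> of the diagram for \<open>(g1, g2)\<close>.\<close>
    define tG' where "tG' = farr (pb H2 F) (\<theta> G ?A)"
    define rG' where "rG' = farr (pb H2 F) (farr (pb H2 G) (\<rho> Y1 Y2 (A1, A2)))"
    define nG' where "nG' = farr (pb H2 F) (m2 g1 g2 (?R1, ?R2))"
    define lG' where "lG' = farr (pb H2 F) (farr (R ?X) (m1 g1 g2 (A1, A2)))"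
    define sG' where "sG' = farr (pb H2 F) (\<rho> X1 X2 (?B1, ?B2))"
    define eG' where "eG' = farr (pb H2 F) (farr (E2 X1 X2) (\<theta> g1 A1, \<theta> g2 A2))"
    \<comment> \<open>The diagram for \<open>(f1, f2)\<close>.\<close>
    define tF where "tF = \<theta> F ?B"
    define nF where "nF = m2 f1 f2 (fobj (R X1) ?B1, fobj (R X2) ?B2)"
    define lF where "lF = farr (R ?T) (m1 f1 f2 (?B1, ?B2))"
    define sF where "sF = \<rho> T1 T2 (fobj (pb H1 f1) ?B1, fobj (pb H1 f2) ?B2)"
    define eF where "eF = farr (E2 T1 T2) (\<theta> f1 ?B1, \<theta> f2 ?B2)"
    \<comment> \<open>The arrows along which the two are pasted.\<close>
    define tF0 where "tF0 = \<theta> F (fobj (pb H1 G) ?A)"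
    define nF0 where "nF0 = m2 f1 f2 (?C1, ?C2)"
    define eFG where "eFG = farr (E2 T1 T2) (farr (pb H2 f1) (\<theta> g1 A1), farr (pb H2 f2) (\<theta> g2 A2))"
    define lFG where "lFG = farr (R ?T) (farr (pb H1 F) (m1 g1 g2 (A1, A2)))"
    define k where "k = farr (R ?T) (conn H1 F G ?A)"
    define kR where "kR = conn H2 F G (fobj (R ?Y) ?A)"
    define kE where "kE = conn H2 F G (fobj (E2 Y1 Y2) (?R1, ?R2))"
    define kC where "kC = farr (E2 T1 T2) (conn H2 f1 g1 ?R1, conn H2 f2 g2 ?R2)"
    define kB where "kB = farr (E2 T1 T2) (farr (R T1) (conn H1 f1 g1 A1), farr (R T2) (conn H1 f2 g2 A2))"
    define kl where "kl = farr (R ?T) (farr (E1 T1 T2) (conn H1 f1 g1 A1, conn H1 f2 g2 A2))"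

    have th_g: "\<theta> g1 A1 \<in> Hom (fib H2 X1) ?C1 (fobj (R X1) ?B1)"
      "\<theta> g2 A2 \<in> Hom (fib H2 X2) ?C2 (fobj (R X2) ?B2)"
      using theta_Hom g A by auto
    have th_f: "\<theta> f1 ?B1 \<in> Hom (fib H2 T1) (fobj (pb H2 f1) (fobj (R X1) ?B1)) (fobj (R T1) (fobj (pb H1 f1) ?B1))"
      "\<theta> f2 ?B2 \<in> Hom (fib H2 T2) (fobj (pb H2 f2) (fobj (R X2) ?B2)) (fobj (R T2) (fobj (pb H1 f2) ?B2))"
      using theta_Hom f B12 by auto
    note th_gf = theta_Hom[OF gf(1) A(1)] theta_Hom[OF gf(2) A(2)]
    note conn1 = H1.conn_Hom[OF f(1) g(1) A(1)] H1.conn_Hom[OF f(2) g(2) A(2)]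
    note conn2 = H2.conn_Hom[OF f(1) g(1) R12(1)] H2.conn_Hom[OF f(2) g(2) R12(2)]
    note pb_th = H2.pb_arr_Hom[OF f(1) th_g(1)] H2.pb_arr_Hom[OF f(2) th_g(2)]
    note R_conn = R_arr_Hom[OF ob(1) conn1(1)] R_arr_Hom[OF ob(2) conn1(2)]
    note rho_A = rho_Hom[OF ob(5,6) A]
    note rho_B = rho_Hom[OF ob(3,4) B12]
    note m1g = T1.m_Hom[OF g A, folded G_def]
    note m2g = T2.m_Hom[OF g R12, folded G_def]
    note m1f = T1.m_Hom[OF f B12, folded F_def]
    note m1gf = T1.m_Hom[OF gf A, unfolded GF]
    note thG = theta_Hom[OF G A']
    note e_g = T2.tensor_arr_Hom[OF ob(3,4) th_g]
    note G_rho = H2.pb_arr_Hom[OF G rho_A]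
    note R_m1g = R_arr_Hom[OF obP(2) m1g]
    note kl_1 = T1.tensor_arr_Hom[OF ob(1,2) conn1]
    note F_m1g = H1.pb_arr_Hom[OF F m1g]
    have ob_gf: "fobj (pb H1 (g1 \<cdot> f1)) A1 \<in> Ob (fib H1 T1)" "fobj (pb H1 (g2 \<cdot> f2)) A2 \<in> Ob (fib H1 T2)"
      "fobj (pb H1 f1) ?B1 \<in> Ob (fib H1 T1)" "fobj (pb H1 f2) ?B2 \<in> Ob (fib H1 T2)"
      using H1.pb_obj gf A f B12 by auto
    have R_B12: "fobj (R X1) ?B1 \<in> Ob (fib H2 X1)" "fobj (R X2) ?B2 \<in> Ob (fib H2 X2)"
      using R_obj ob B12 by auto

    note typing =
      theta_Hom[OF GF_Hom A', folded t_def D_def, THEN HomD]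
      H2.pb_arr_Hom[OF GF_Hom rho_A, folded r_def D_def, THEN HomD]
      T2.m_Hom[OF gf R12, unfolded GF, folded n_def D_def, THEN HomD]
      R_arr_Hom[OF obP(1) m1gf, folded l_def D_def, THEN HomD]
      rho_Hom[OF ob(1,2) ob_gf(1,2), folded s_def D_def, THEN HomD]
      T2.tensor_arr_Hom[OF ob(1,2) th_gf, folded e_def D_def, THEN HomD]
      H2.pb_arr_Hom[OF F thG, folded tG'_def D_def, THEN HomD]
      H2.pb_arr_Hom[OF F G_rho, folded rG'_def D_def, THEN HomD]
      H2.pb_arr_Hom[OF F m2g, folded nG'_def D_def, THEN HomD]
      H2.pb_arr_Hom[OF F R_m1g, folded lG'_def D_def, THEN HomD]
      H2.pb_arr_Hom[OF F rho_B, folded sG'_def D_def, THEN HomD]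
      H2.pb_arr_Hom[OF F e_g, folded eG'_def D_def, THEN HomD]
      theta_Hom[OF F B', folded tF_def D_def, THEN HomD]
      T2.m_Hom[OF f R_B12, folded F_def nF_def D_def, THEN HomD]
      R_arr_Hom[OF obP(1) m1f, folded lF_def D_def, THEN HomD]
      rho_Hom[OF ob(1,2) ob_gf(3,4), folded sF_def D_def, THEN HomD]
      T2.tensor_arr_Hom[OF ob(1,2) th_f, folded eF_def D_def, THEN HomD]
      theta_Hom[OF F GA, folded tF0_def D_def, THEN HomD]
      T2.m_Hom[OF f C12, folded F_def nF0_def D_def, THEN HomD]
      T2.tensor_arr_Hom[OF ob(1,2) pb_th, folded eFG_def D_def, THEN HomD]
      R_arr_Hom[OF obP(1) F_m1g, folded lFG_def D_def, THEN HomD]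
      R_arr_Hom[OF obP(1) H1.conn_Hom[OF F G A'], folded k_def D_def, THEN HomD]
      H2.conn_Hom[OF F G RA', folded kR_def D_def, THEN HomD]
      H2.conn_Hom[OF F G RR, folded kE_def D_def, THEN HomD]
      T2.tensor_arr_Hom[OF ob(1,2) conn2, folded kC_def D_def, THEN HomD]
      T2.tensor_arr_Hom[OF ob(1,2) R_conn, folded kB_def D_def, THEN HomD]
      R_arr_Hom[OF obP(1) kl_1, folded kl_def D_def, THEN HomD]
    note reassoc = D.Comp_assoc_right D.Comp_in_Ar typing

    \<comment> \<open>Cocycle conditions; that of \<open>m1\<close> is transported to \<open>D\<close> by \<open>R\<close>, and those of \<open>\<theta>\<close> for
      \<open>(f1, g1)\<close> and \<open>(f2, g2)\<close> are combined into one by \<open>\<boxtimes>\<close>.\<close>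
    have theta_GF: "k \<cdot>\<^bsub>D\<^esub> t = tF0 \<cdot>\<^bsub>D\<^esub> tG' \<cdot>\<^bsub>D\<^esub> kR"
      using theta_comp[OF F G A'] unfolding k_def t_def tF0_def tG'_def kR_def D .
    have m2_gf: "kE \<cdot>\<^bsub>D\<^esub> n = nG' \<cdot>\<^bsub>D\<^esub> nF0 \<cdot>\<^bsub>D\<^esub> kC"
      using T2.m_comp[OF f(1) g(1) f(2) g(2) R12]
      unfolding kE_def n_def nG'_def nF0_def kC_def D F_def G_def .
    have "conn H1 F G ?A \<cdot>\<^bsub>fib H1 ?T\<^esub> m1 (g1 \<cdot> f1) (g2 \<cdot> f2) (A1, A2)
        = farr (pb H1 F) (m1 g1 g2 (A1, A2)) \<cdot>\<^bsub>fib H1 ?T\<^esub> m1 f1 f2 (?B1, ?B2)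
          \<cdot>\<^bsub>fib H1 ?T\<^esub> farr (E1 T1 T2) (conn H1 f1 g1 A1, conn H1 f2 g2 A2)"
      using T1.m_comp[OF f(1) g(1) f(2) g(2) A] unfolding F_def G_def .
    then have m1_gf: "k \<cdot>\<^bsub>D\<^esub> l = lFG \<cdot>\<^bsub>D\<^esub> lF \<cdot>\<^bsub>D\<^esub> kl"
      using R_arr_Comp[OF obP(1) m1gf H1.conn_Hom[OF F G A']]
        R_arr_Comp[OF obP(1) kl_1 m1f]
        R_arr_Comp[OF obP(1) category.Comp_Hom[OF H1.fib_category[OF obP(1)] kl_1 m1f] F_m1g]
      unfolding k_def l_def lFG_def lF_def kl_def D by simp
    have theta_gf: "kB \<cdot>\<^bsub>D\<^esub> e = eF \<cdot>\<^bsub>D\<^esub> eFG \<cdot>\<^bsub>D\<^esub> kC"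
      using theta_comp[OF f(1) g(1) A(1)] theta_comp[OF f(2) g(2) A(2)]
        T2.tensor_arr_Comp[OF ob(1,2) th_gf R_conn]
        T2.tensor_arr_Comp[OF ob(1,2) conn2 pb_th]
        T2.tensor_arr_Comp[OF ob(1,2)
          category.Comp_Hom[OF H2.fib_category[OF ob(1)] conn2(1) pb_th(1)]
          category.Comp_Hom[OF H2.fib_category[OF ob(2)] conn2(2) pb_th(2)] th_f]
      unfolding kB_def e_def eF_def eFG_def kC_def D by simp

    \<comment> \<open>Naturality squares, which fill the region between the two diagrams.\<close>
    have conn_rho: "kR \<cdot>\<^bsub>D\<^esub> r = rG' \<cdot>\<^bsub>D\<^esub> kE"
      using H2.conn_naturality[OF F G rho_A] unfolding kR_def r_def rG'_def kE_def D .
    have m2_theta: "eG' \<cdot>\<^bsub>D\<^esub> nF0 = nF \<cdot>\<^bsub>D\<^esub> eFG"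
      using T2.m_naturality[OF f th_g] unfolding eG'_def nF0_def nF_def eFG_def D F_def .
    have theta_m1: "tF0 \<cdot>\<^bsub>D\<^esub> lG' = lFG \<cdot>\<^bsub>D\<^esub> tF"
      using theta_naturality[OF F m1g] unfolding tF0_def lG'_def lFG_def tF_def D .
    have rho_conn: "sF \<cdot>\<^bsub>D\<^esub> kB = kl \<cdot>\<^bsub>D\<^esub> s"
      using rho_naturality[OF ob(1,2) conn1] unfolding sF_def kB_def kl_def s_def D by simp

    \<comment> \<open>The hypothesis on \<open>(f1, f2)\<close> is used at the pullbacks of \<open>A1\<close> and \<open>A2\<close> along \<open>g1\<close> and \<open>g2\<close>;
      the one on \<open>(g1, g2)\<close> is pulled back along \<open>F\<close>.\<close>
    have cF: "tF \<cdot>\<^bsub>D\<^esub> sG' \<cdot>\<^bsub>D\<^esub> nF = lF \<cdot>\<^bsub>D\<^esub> sF \<cdot>\<^bsub>D\<^esub> eF"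
      using compat_f B12 HomD[OF f(1)] HomD[OF f(2)]
      unfolding rho_compatible_def tF_def sG'_def nF_def lF_def sF_def eF_def D_def F_def
      by (simp add: Let_def)
    have "\<theta> G ?A \<cdot>\<^bsub>fib H2 ?X\<^esub> farr (pb H2 G) (\<rho> Y1 Y2 (A1, A2)) \<cdot>\<^bsub>fib H2 ?X\<^esub> m2 g1 g2 (?R1, ?R2)
        = farr (R ?X) (m1 g1 g2 (A1, A2)) \<cdot>\<^bsub>fib H2 ?X\<^esub> \<rho> X1 X2 (?B1, ?B2)
          \<cdot>\<^bsub>fib H2 ?X\<^esub> farr (E2 X1 X2) (\<theta> g1 A1, \<theta> g2 A2)"
      using compat_g A HomD[OF g(1)] HomD[OF g(2)]
      unfolding rho_compatible_def G_def by (simp add: Let_def)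
    then have cG: "tG' \<cdot>\<^bsub>D\<^esub> rG' \<cdot>\<^bsub>D\<^esub> nG' = lG' \<cdot>\<^bsub>D\<^esub> sG' \<cdot>\<^bsub>D\<^esub> eG'"
      using H2.pb_arr_Comp[OF F m2g G_rho]
        H2.pb_arr_Comp[OF F category.Comp_Hom[OF H2.fib_category[OF obP(2)] m2g G_rho] thG]
        H2.pb_arr_Comp[OF F e_g rho_B]
        H2.pb_arr_Comp[OF F category.Comp_Hom[OF H2.fib_category[OF obP(2)] e_g rho_B] R_m1g]
      unfolding tG'_def rG'_def nG'_def lG'_def sG'_def eG'_def D by simp

    \<comment> \<open>Push the connection isomorphisms from the target of the diagram to its source, and back
      along the other side.\<close>
    have "k \<cdot>\<^bsub>D\<^esub> (t \<cdot>\<^bsub>D\<^esub> r \<cdot>\<^bsub>D\<^esub> n) = (k \<cdot>\<^bsub>D\<^esub> t) \<cdot>\<^bsub>D\<^esub> r \<cdot>\<^bsub>D\<^esub> n"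
      by (simp add: reassoc)
    also have "\<dots> = tF0 \<cdot>\<^bsub>D\<^esub> tG' \<cdot>\<^bsub>D\<^esub> (kR \<cdot>\<^bsub>D\<^esub> r) \<cdot>\<^bsub>D\<^esub> n"
      unfolding theta_GF by (simp add: reassoc)
    also have "\<dots> = tF0 \<cdot>\<^bsub>D\<^esub> tG' \<cdot>\<^bsub>D\<^esub> rG' \<cdot>\<^bsub>D\<^esub> (kE \<cdot>\<^bsub>D\<^esub> n)"
      unfolding conn_rho by (simp add: reassoc)
    also have "\<dots> = tF0 \<cdot>\<^bsub>D\<^esub> (tG' \<cdot>\<^bsub>D\<^esub> rG' \<cdot>\<^bsub>D\<^esub> nG') \<cdot>\<^bsub>D\<^esub> nF0 \<cdot>\<^bsub>D\<^esub> kC"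
      unfolding m2_gf by (simp add: reassoc)
    also have "\<dots> = (tF0 \<cdot>\<^bsub>D\<^esub> lG') \<cdot>\<^bsub>D\<^esub> sG' \<cdot>\<^bsub>D\<^esub> (eG' \<cdot>\<^bsub>D\<^esub> nF0) \<cdot>\<^bsub>D\<^esub> kC"
      unfolding cG by (simp add: reassoc)
    also have "\<dots> = lFG \<cdot>\<^bsub>D\<^esub> (tF \<cdot>\<^bsub>D\<^esub> sG' \<cdot>\<^bsub>D\<^esub> nF) \<cdot>\<^bsub>D\<^esub> eFG \<cdot>\<^bsub>D\<^esub> kC"
      unfolding theta_m1 m2_theta by (simp add: reassoc)
    also have "\<dots> = lFG \<cdot>\<^bsub>D\<^esub> lF \<cdot>\<^bsub>D\<^esub> sF \<cdot>\<^bsub>D\<^esub> (eF \<cdot>\<^bsub>D\<^esub> eFG \<cdot>\<^bsub>D\<^esub> kC)"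
      unfolding cF by (simp add: reassoc)
    also have "\<dots> = lFG \<cdot>\<^bsub>D\<^esub> lF \<cdot>\<^bsub>D\<^esub> (sF \<cdot>\<^bsub>D\<^esub> kB) \<cdot>\<^bsub>D\<^esub> e"
      unfolding theta_gf[symmetric] by (simp add: reassoc)
    also have "\<dots> = (lFG \<cdot>\<^bsub>D\<^esub> lF \<cdot>\<^bsub>D\<^esub> kl) \<cdot>\<^bsub>D\<^esub> s \<cdot>\<^bsub>D\<^esub> e"
      unfolding rho_conn by (simp add: reassoc)
    also have "\<dots> = k \<cdot>\<^bsub>D\<^esub> (l \<cdot>\<^bsub>D\<^esub> s \<cdot>\<^bsub>D\<^esub> e)"
      unfolding m1_gf[symmetric] by (simp add: reassoc)
    finally have chase: "k \<cdot>\<^bsub>D\<^esub> (t \<cdot>\<^bsub>D\<^esub> r \<cdot>\<^bsub>D\<^esub> n) = k \<cdot>\<^bsub>D\<^esub> (l \<cdot>\<^bsub>D\<^esub> s \<cdot>\<^bsub>D\<^esub> e)" .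

    have "is_iso D k"
      unfolding k_def D_def
      using category_functor.preserves_iso[OF R_functor[OF obP(1)] H1.conn_iso[OF F G A']] .
    moreover have "k \<in> Hom D (Cod D t) (Cod D k)"
      "t \<cdot>\<^bsub>D\<^esub> r \<cdot>\<^bsub>D\<^esub> n \<in> Hom D (Dom D n) (Cod D t)"
      "l \<cdot>\<^bsub>D\<^esub> s \<cdot>\<^bsub>D\<^esub> e \<in> Hom D (Dom D n) (Cod D t)"
      by (simp_all add: Hom_def reassoc)
    ultimately have "t \<cdot>\<^bsub>D\<^esub> r \<cdot>\<^bsub>D\<^esub> n = l \<cdot>\<^bsub>D\<^esub> s \<cdot>\<^bsub>D\<^esub> e"
      using chase D.iso_cancel_left by blast
    then show ?thesis
      unfolding t_def r_def n_def l_def s_def e_def .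
  qed
  show ?thesis
    unfolding rho_compatible_def
    using eq HomD[OF gf(1)] HomD[OF gf(2)] by (simp add: Let_def GF D_def)
qed

end

section \<open>Skeletons and structures\<close>

text \<open>The axiom for \<open>M\<close> evaluates the structure maps at pairs of arrows of \<open>M\<close> only, where \<open>restrict_m M\<close>
  changes nothing.\<close>

lemma external_tensor_structure_on_morphism_restrict:
  "external_tensor_structure_on_morphism S M H1 E1 (restrict_m M m1) H2 E2 (restrict_m M m2) R \<theta> \<rho>
   \<longleftrightarrow> external_tensor_structure_on_morphism S M H1 E1 m1 H2 E2 m2 R \<theta> \<rho>"
  unfolding external_tensor_structure_on_morphism_def
  by (intro conj_cong refl all_cong1 imp_cong) (simp add: restrict_m_def)

lemma external_tensor_structure_on_morphism_natural_iso:
  "\<lbrakk>external_tensor_structure_on_morphism S M H1 E1 m1 H2 E2 m2 R \<theta> \<rho>; X1 \<in> Ob S; X2 \<in> Ob S\<rbrakk>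
   \<Longrightarrow> natural_iso (prod_category (fib H1 X1) (fib H1 X2)) (fib H2 (Prod S X1 X2))
         (E2 X1 X2 \<circ>\<^sub>F (R X1 \<times>\<^sub>F R X2)) (R (Prod S X1 X2) \<circ>\<^sub>F E1 X1 X2) (\<rho> X1 X2)"
  unfolding external_tensor_structure_on_morphism_def by blast

lemma external_tensor_structure_on_morphism_mono:
  "\<lbrakk>external_tensor_structure_on_morphism S M H1 E1 m1 H2 E2 m2 R \<theta> \<rho>; N \<subseteq> M\<rbrakk>
   \<Longrightarrow> external_tensor_structure_on_morphism S N H1 E1 m1 H2 E2 m2 R \<theta> \<rho>"
  unfolding external_tensor_structure_on_morphism_def by blast

lemma (in tensor_comparison) external_tensor_structure_on_morphism_iff:
  assumes "M \<subseteq> Ar S"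
  shows "external_tensor_structure_on_morphism S M H1 E1 m1 H2 E2 m2 R \<theta> \<rho>
     \<longleftrightarrow> (\<forall>f1\<in>M. \<forall>f2\<in>M. rho_compatible f1 f2)"
proof -
  have "(\<forall>T1 X1 T2 X2 f1 f2 A1 A2.
          f1 \<in> M \<inter> Hom S T1 X1 \<and> f2 \<in> M \<inter> Hom S T2 X2 \<and>
          A1 \<in> Ob (fib H1 X1) \<and> A2 \<in> Ob (fib H1 X2) \<longrightarrow> P T1 X1 T2 X2 f1 f2 A1 A2)
     \<longleftrightarrow> (\<forall>f1\<in>M. \<forall>f2\<in>M. \<forall>A1 \<in> Ob (fib H1 (Cod S f1)). \<forall>A2 \<in> Ob (fib H1 (Cod S f2)).
          P (Dom S f1) (Cod S f1) (Dom S f2) (Cod S f2) f1 f2 A1 A2)" for P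
    using assms by (auto simp: Hom_def subset_iff)
  then show ?thesis
    unfolding external_tensor_structure_on_morphism_def rho_compatible_def Let_def
    using rho_natural_iso by simp
qed

theorem proposition4p9:
  fixes S :: "('o, 'm) product_category_data"
    and sm cl :: "'m set"
    and H1 :: "('o, 'm, 'a1, 'b1) fibered_data"
    and E1 :: "'o \<Rightarrow> 'o \<Rightarrow> ('a1 \<times> 'a1, 'b1 \<times> 'b1, 'a1, 'b1) functor_data"
    and m1 :: "'m \<Rightarrow> 'm \<Rightarrow> 'a1 \<times> 'a1 \<Rightarrow> 'b1"
    and H2 :: "('o, 'm, 'a2, 'b2) fibered_data"
    and E2 :: "'o \<Rightarrow> 'o \<Rightarrow> ('a2 \<times> 'a2, 'b2 \<times> 'b2, 'a2, 'b2) functor_data"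
    and m2 :: "'m \<Rightarrow> 'm \<Rightarrow> 'a2 \<times> 'a2 \<Rightarrow> 'b2"
    and R :: "'o \<Rightarrow> ('a1, 'b1, 'a2, 'b2) functor_data"
    and \<theta> :: "'m \<Rightarrow> 'a1 \<Rightarrow> 'b2"
    and \<rho> :: "'o \<Rightarrow> 'o \<Rightarrow> 'a1 \<times> 'a1 \<Rightarrow> 'b2"
  assumes "base_category S sm cl"
    and "external_tensor_structure S H1 E1 m1"
    and "external_tensor_structure S H2 E2 m2"
    and "fibered_morphism S H1 H2 R \<theta>"
  shows "external_tensor_skeleton_on_morphism S sm cl
           H1 E1 (restrict_m sm m1) (restrict_m cl m1)
           H2 E2 (restrict_m sm m2) (restrict_m cl m2) R \<theta> \<rho> \<rho>
     \<longleftrightarrow> external_tensor_structure_on_morphism S (Ar S) H1 E1 m1 H2 E2 m2 R \<theta> \<rho>"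
proof -
  interpret base: base_category S sm cl by fact
  have sub: "sm \<subseteq> Ar S" "cl \<subseteq> Ar S"
    using base.sm_subcategory base.cl_subcategory by (auto simp: wide_subcategory_with_isos_def)
  let ?str = "\<lambda>M. external_tensor_structure_on_morphism S M H1 E1 m1 H2 E2 m2 R \<theta> \<rho>"
  have "?str sm \<and> ?str cl \<longleftrightarrow> ?str (Ar S)"
  proof
    assume "?str (Ar S)"
    then show "?str sm \<and> ?str cl"
      using sub external_tensor_structure_on_morphism_mono by blast
  next
    assume skel: "?str sm \<and> ?str cl"
    interpret tensor_comparison S H1 E1 m1 H2 E2 m2 R \<theta> \<rho>
      using external_tensor_structure_on_morphism_natural_iso[OF conjunct1[OF skel]]
      by (intro tensor_comparison.intro tensor_comparison_axioms.intro assms(2-4))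
    have "rho_compatible f1 f2" if f: "f1 \<in> Ar S" "f2 \<in> Ar S" for f1 f2
    proof -
      obtain t1 p1 where 1: "t1 \<in> cl" "p1 \<in> sm" "Cod S t1 = Dom S p1" "f1 = p1 \<cdot>\<^bsub>S\<^esub> t1"
        using base.sm_cl_factorization[OF f(1)] by blast
      obtain t2 p2 where 2: "t2 \<in> cl" "p2 \<in> sm" "Cod S t2 = Dom S p2" "f2 = p2 \<cdot>\<^bsub>S\<^esub> t2"
        using base.sm_cl_factorization[OF f(2)] by blast
      have "rho_compatible t1 t2" "rho_compatible p1 p2"
        using skel sub 1 2 by (simp_all add: external_tensor_structure_on_morphism_iff)
      then show ?thesis
        using 1 2 sub
          rho_compatible_Comp[of t1 "Dom S t1" "Dom S p1" t2 "Dom S t2" "Dom S p2"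
            p1 "Cod S p1" p2 "Cod S p2"]
        by (auto simp: Hom_def)
    qed
    then show "?str (Ar S)"
      by (simp add: external_tensor_structure_on_morphism_iff)
  qed
  then show ?thesis
    unfolding external_tensor_skeleton_on_morphism_def
      external_tensor_structure_on_morphism_restrict by simp
qed

end
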